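(* Let $K,M:\mathbb{R}^m_{\ge0}\to\mathbb{S}^n_{\succeq0}$ be continuous with $K(x)\succ0$ and $M(x)\succ0$ for every $x\in\mathbb{R}^m_{>0}$, let $l\in\mathbb{R}^m$ have positive components, and let $V_0>0$. Define, for $x\in\mathbb{R}^m_{\ge0}$ and $\epsilon>0$, $$\varphi(x):=\lambda_{\max}(M(x),K(x)),\qquad \varphi^\epsilon(x):=\lambda_{\max}(M(x),K(x)+\epsilon I).$$ For each $\epsilon>0$ let $x^\epsilon$ be an optimal solution of $$\min_{x\in\mathbb{R}^m_{\ge0}}\ \varphi^\epsilon(x)\quad\text{subject to}\quad l^\top x=V_0.$$ Then $\lim_{\epsilon\to0}\varphi^\epsilon(x^\epsilon)=\varphi(x^* )$, where $x^*$ is an optimal solution of $$\min_{x\in\mathbb{R}^m_{\ge0}}\ \varphi(x)\quad\text{subject to}\quad l^\top x=V_0,$$ and any limit point of $\{x^\epsilon\}$ as $\epsilon\to0$ is an optimal solution of the latter problem.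
   Context: $\mathbb{R}^m_{\ge0}$ and $\mathbb{R}^m_{>0}$ are the sets of vectors in $\mathbb{R}^m$ with nonnegative, respectively positive, components; $\mathbb{S}^n_{\succeq0}$ is the set of real symmetric positive semidefinite $n\times n$ matrices; $\mathrm{Ker}\,Y=\{v\in\mathbb{R}^n\mid Yv=0\}$. For $X,Y\in\mathbb{S}^n_{\succeq0}$, $$\lambda_{\max}(X,Y):=\begin{cases}\displaystyle\sup_{v\notin\mathrm{Ker}\,Y}\frac{v^\top Xv}{v^\top Yv} & (Y\neq0),\\ \infty & (X\neq0,\ Y=0),\\ 0 & (X=Y=0).\end{cases}$$ A limit point of $\{x^\epsilon\}$ as $\epsilon\to0$ is a point $\bar x$ such that $x^{\epsilon_k}\to\bar x$ for some sequence $\epsilon_k>0$ with $\epsilon_k\to0$. *)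

theory Defs
  imports "HOL-Analysis.Analysis"
begin

definition nonneg_orthant :: "(real ^ 'm) set" where
  "nonneg_orthant = {x. \<forall>i. 0 \<le> x $ i}"

definition pos_orthant :: "(real ^ 'm) set" where
  "pos_orthant = {x. \<forall>i. 0 < x $ i}"

definition psd :: "real ^ 'n ^ 'n \<Rightarrow> bool" where
  "psd A \<longleftrightarrow> transpose A = A \<and> (\<forall>v. 0 \<le> v \<bullet> (A *v v))"

definition pos_def :: "real ^ 'n ^ 'n \<Rightarrow> bool" where
  "pos_def A \<longleftrightarrow> transpose A = A \<and> (\<forall>v. v \<noteq> 0 \<longrightarrow> 0 < v \<bullet> (A *v v))"

definition matrix_ker :: "real ^ 'n ^ 'n \<Rightarrow> (real ^ 'n) set" where
  "matrix_ker A = {v. A *v v = 0}"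

(* Extended-real valued: even for Y \<noteq> 0 the supremum is infinite
   when Ker Y is not contained in Ker X. Only meaningful for X, Y positive semidefinite. *)
definition lambda_max :: "real ^ 'n ^ 'n \<Rightarrow> real ^ 'n ^ 'n \<Rightarrow> ereal" where
  "lambda_max X Y =
     (if Y \<noteq> 0 then (SUP v \<in> - matrix_ker Y. ereal ((v \<bullet> (X *v v)) / (v \<bullet> (Y *v v))))
      else if X \<noteq> 0 then \<infinity>
      else 0)"

definition feasible :: "real ^ 'm \<Rightarrow> real \<Rightarrow> (real ^ 'm) set" where
  "feasible l V0 = {x \<in> nonneg_orthant. l \<bullet> x = V0}"

definition phi ::
  "(real ^ 'm \<Rightarrow> real ^ 'n ^ 'n) \<Rightarrow> (real ^ 'm \<Rightarrow> real ^ 'n ^ 'n) \<Rightarrow> real ^ 'm \<Rightarrow> ereal" where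
  "phi K M x = lambda_max (M x) (K x)"

definition phi_eps ::
  "(real ^ 'm \<Rightarrow> real ^ 'n ^ 'n) \<Rightarrow> (real ^ 'm \<Rightarrow> real ^ 'n ^ 'n) \<Rightarrow> real \<Rightarrow> real ^ 'm \<Rightarrow> ereal" where
  "phi_eps K M \<epsilon> x = lambda_max (M x) (K x + \<epsilon> *\<^sub>R mat 1)"

definition optimal_solution :: "('a \<Rightarrow> ereal) \<Rightarrow> 'a set \<Rightarrow> 'a \<Rightarrow> bool" where
  "optimal_solution f S x \<longleftrightarrow> is_arg_min f (\<lambda>y. y \<in> S) x"

definition limit_point_at_0 :: "(real \<Rightarrow> 'a::topological_space) \<Rightarrow> 'a \<Rightarrow> bool" where
  "limit_point_at_0 x p \<longleftrightarrow>
     (\<exists>e :: nat \<Rightarrow> real. (\<forall>k. 0 < e k) \<and> e \<longlonglongrightarrow> 0 \<and> (\<lambda>k. x (e k)) \<longlonglongrightarrow> p)"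

end

theory Submission
  imports Defs
begin

text \<open>
  For \<open>c \<ge> 0\<close> and positive semidefinite \<open>X\<close>, \<open>Y\<close>, the inequality \<open>\<lambda>\<^sub>m\<^sub>a\<^sub>x(X, Y) \<le> c\<close> says exactly that
  \<open>c Y - X\<close> is positive semidefinite, including in the degenerate cases. This condition is closed
  in \<open>(X, Y)\<close>, so \<open>(\<epsilon>, y) \<mapsto> \<phi>\<^sup>\<epsilon>(y)\<close> is lower semicontinuous down to \<open>\<epsilon> = 0\<close>, and it is
  monotone in \<open>Y\<close>, so \<open>\<phi>\<^sup>\<epsilon>\<close> increases to at most \<open>\<phi>\<close> as \<open>\<epsilon>\<close> decreases to \<open>0\<close>. Hence limit points of
  \<open>x\<^sup>\<epsilon>\<close> minimise \<open>\<phi>\<close>; they exist because the feasible set is compact, and the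
  monotone optimal values cannot stay below the minimum of \<open>\<phi>\<close>.
\<close>

section \<open>Quadratic forms of semidefinite matrices\<close>

lemma quadratic_form_add:
  fixes A :: "real ^ 'n ^ 'n"
  assumes "transpose A = A"
  shows "(v + t *\<^sub>R w) \<bullet> (A *v (v + t *\<^sub>R w))
    = v \<bullet> (A *v v) + 2 * t * (w \<bullet> (A *v v)) + t\<^sup>2 * (w \<bullet> (A *v w))"
proof -
  have "v \<bullet> (A *v w) = w \<bullet> (A *v v)"
    by (metis assms dot_lmul_matrix inner_commute vector_transpose_matrix)
  then show ?thesis
    by (simp add: matrix_vector_right_distrib inner_add_left inner_add_right
        matrix_vector_mult_scaleR power2_eq_square algebra_simps)
qed

text \<open>If \<open>w = A *v v\<close> were nonzero, a small step from \<open>v\<close> along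
  \<open>- w\<close> would make the form negative: the linear term
  \<open>2 * t * (w \<bullet> w)\<close> dominates the quadratic one.\<close>

lemma psd_quadratic_form_eq_0:
  assumes "psd A" and "v \<bullet> (A *v v) = 0"
  shows "A *v v = 0"
proof (rule ccontr)
  assume "A *v v \<noteq> 0"
  define w where "w = A *v v"
  define a where "a = w \<bullet> w"
  define b where "b = w \<bullet> (A *v w)"
  \<comment> \<open>The minimiser would be \<open>- a / b\<close>; the \<open>+ 1\<close> covers
    \<open>b = 0\<close> and still keeps \<open>t * b \<ge> - a\<close>.\<close>
  define t where "t = - a / (b + 1)"
  have a: "a > 0" using \<open>A *v v \<noteq> 0\<close> by (simp add: a_def w_def)
  have b: "b \<ge> 0" using assms(1) by (simp add: b_def psd_def)
  have "0 \<le> (v + t *\<^sub>R w) \<bullet> (A *v (v + t *\<^sub>R w))"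
    using assms(1) by (simp add: psd_def)
  also have "\<dots> = t * (2 * a + t * b)"
    using assms by (subst quadratic_form_add)
      (auto simp: psd_def a_def b_def power2_eq_square algebra_simps simp flip: w_def)
  finally have "0 \<le> t * (2 * a + t * b)" .
  moreover have "t < 0" using a b by (simp add: t_def divide_neg_pos)
  moreover have "2 * a + t * b > 0"
  proof -
    have "a * b \<le> a * (b + 1)" using a by simp
    then have "a * b / (b + 1) \<le> a" using b by (simp add: divide_le_eq)
    then show ?thesis using a by (simp add: t_def)
  qed
  ultimately show False by (simp add: zero_le_mult_iff)
qed

lemma psd_quadratic_form_pos:
  assumes "psd A" and "v \<notin> matrix_ker A"
  shows "0 < v \<bullet> (A *v v)"
  using assms psd_quadratic_form_eq_0[of A v]
  by (force simp: psd_def matrix_ker_def less_le)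

lemma ex_notin_matrix_ker:
  assumes "A \<noteq> 0"
  obtains v where "v \<notin> matrix_ker A"
  using assms by (auto simp: matrix_ker_def matrix_eq)

section \<open>Sublevel sets of \<open>lambda_max\<close>\<close>

lemma lambda_max_nonneg:
  assumes "psd X" and "psd Y"
  shows "0 \<le> lambda_max X Y"
proof (cases "Y = 0")
  case False
  then obtain v where v: "v \<notin> matrix_ker Y" by (rule ex_notin_matrix_ker)
  have "0 \<le> ereal ((v \<bullet> (X *v v)) / (v \<bullet> (Y *v v)))"
    using assms by (simp add: psd_def)
  also have "\<dots> \<le> lambda_max X Y"
    using False v by (auto simp: lambda_max_def intro!: SUP_upper)
  finally show ?thesis .
qed (simp add: lambda_max_def)

text \<open>Off the kernel of \<open>Y\<close> this clears a positive denominator. If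
  \<open>Y \<noteq> 0\<close>, the kernel is a proper subspace, so its complement is dense and
  continuity carries the inequality to all \<open>v\<close>.\<close>

lemma lambda_max_le_iff:
  fixes X Y :: "real ^ 'n ^ 'n"
  assumes X: "psd X" and Y: "psd Y" and c: "0 \<le> c"
  shows "lambda_max X Y \<le> ereal c \<longleftrightarrow> (\<forall>v. v \<bullet> (X *v v) \<le> c * (v \<bullet> (Y *v v)))"
    (is "?L \<longleftrightarrow> ?R")
proof (cases "Y = 0")
  case True
  show ?thesis
  proof (cases "X = 0")
    case False
    then obtain v where "v \<notin> matrix_ker X" by (rule ex_notin_matrix_ker)
    with X have "0 < v \<bullet> (X *v v)" by (rule psd_quadratic_form_pos)
    with True False show ?thesis by (auto simp: lambda_max_def not_le)
  qed (use True c in \<open>simp add: lambda_max_def\<close>)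
next
  case False
  have L: "?L \<longleftrightarrow> (\<forall>v. v \<notin> matrix_ker Y \<longrightarrow> v \<bullet> (X *v v) \<le> c * (v \<bullet> (Y *v v)))"
    using False psd_quadratic_form_pos[OF Y]
    by (auto simp: lambda_max_def SUP_le_iff divide_le_eq)
  show ?thesis
  proof
    assume ?L
    show ?R
    proof
      fix v
      obtain w where w: "w \<notin> matrix_ker Y" using False by (rule ex_notin_matrix_ker)
      show "v \<bullet> (X *v v) \<le> c * (v \<bullet> (Y *v v))"
      proof (cases "v \<in> matrix_ker Y")
        case True
        \<comment> \<open>Approach \<open>v\<close> along \<open>v + t w\<close>, which lies outside the kernel for \<open>t \<noteq> 0\<close>.\<close>
        let ?q = "\<lambda>A t. v \<bullet> (A *v v) + 2 * t * (w \<bullet> (A *v v)) + t\<^sup>2 * (w \<bullet> (A *v w))"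
        have "?q X t \<le> c * ?q Y t" if "t \<noteq> 0" for t
        proof -
          have "v + t *\<^sub>R w \<notin> matrix_ker Y"
            using True w that
            by (simp add: matrix_ker_def matrix_vector_right_distrib matrix_vector_mult_scaleR)
          then show ?thesis
            using L \<open>?L\<close> X Y by (simp add: psd_def flip: quadratic_form_add)
        qed
        then have ev: "\<forall>\<^sub>F t in at 0. ?q X t \<le> c * ?q Y t"
          by (auto simp: eventually_at_filter)
        have lim: "(?q A \<longlongrightarrow> ?q A 0) (at 0)" for A
          by (intro tendsto_intros)
        have "?q X 0 \<le> c * ?q Y 0"
          by (rule tendsto_le[OF _ tendsto_mult[OF tendsto_const lim] lim ev]) simp
        then show ?thesis by simp
      qed (use L \<open>?L\<close> in blast)
    qed
  qed (use L in blast)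
qed

text \<open>The two suprema may range over different vectors, as the kernels can differ; the
  sublevel inequalities are quantified over all \<open>v\<close> and compare directly.\<close>

lemma lambda_max_antimono:
  assumes "psd X" "psd Y" "psd Y'"
    and le: "\<And>v. v \<bullet> (Y *v v) \<le> v \<bullet> (Y' *v v)"
  shows "lambda_max X Y' \<le> lambda_max X Y"
proof (cases "lambda_max X Y")
  case (real c)
  have c: "0 \<le> c" using lambda_max_nonneg[OF assms(1,2)] real by simp
  have "v \<bullet> (X *v v) \<le> c * (v \<bullet> (Y' *v v))" for v
  proof -
    have "v \<bullet> (X *v v) \<le> c * (v \<bullet> (Y *v v))"
      using lambda_max_le_iff[OF assms(1,2) c] real by simp
    also have "\<dots> \<le> c * (v \<bullet> (Y' *v v))"
      using le c by (rule mult_left_mono)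
    finally show ?thesis .
  qed
  then show ?thesis using lambda_max_le_iff[OF assms(1,3) c] real by simp
qed (use lambda_max_nonneg[OF assms(1,2)] in auto)

lemma tendsto_quadratic_form:
  fixes A :: "nat \<Rightarrow> real ^ 'n ^ 'n"
  assumes "A \<longlonglongrightarrow> B"
  shows "(\<lambda>k. v \<bullet> (A k *v v)) \<longlonglongrightarrow> v \<bullet> (B *v v)"
  unfolding inner_vec_def matrix_vector_mult_def
  using assms by (auto intro!: tendsto_intros)

text \<open>For fixed \<open>v\<close> the sublevel inequality is linear in the two matrices, so it
  survives the limit even where the kernel of \<open>Y'\<close> is larger than those of the
  \<open>Y k\<close>.\<close>

lemma lambda_max_closed_sublevel:
  fixes X Y :: "nat \<Rightarrow> real ^ 'n ^ 'n"
  assumes "X \<longlonglongrightarrow> X'" "Y \<longlonglongrightarrow> Y'"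
    and "\<And>k. psd (X k)" "\<And>k. psd (Y k)" "psd X'" "psd Y'"
    and c: "0 \<le> c" and le: "\<And>k. lambda_max (X k) (Y k) \<le> ereal c"
  shows "lambda_max X' Y' \<le> ereal c"
proof -
  have "v \<bullet> (X' *v v) \<le> c * (v \<bullet> (Y' *v v))" for v
  proof (rule LIMSEQ_le)
    show "(\<lambda>k. v \<bullet> (X k *v v)) \<longlonglongrightarrow> v \<bullet> (X' *v v)"
      using assms(1) by (rule tendsto_quadratic_form)
    show "(\<lambda>k. c * (v \<bullet> (Y k *v v))) \<longlonglongrightarrow> c * (v \<bullet> (Y' *v v))"
      using assms(2) by (intro tendsto_intros tendsto_quadratic_form)
    show "\<exists>N. \<forall>k\<ge>N. v \<bullet> (X k *v v) \<le> c * (v \<bullet> (Y k *v v))"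
      using le lambda_max_le_iff[OF assms(3,4) c] by blast
  qed
  then show ?thesis using lambda_max_le_iff[OF assms(5,6) c] by blast
qed

section \<open>The regularised matrix and the feasible set\<close>

lemma quadratic_form_add_scaled_mat_1:
  fixes A :: "real ^ 'n ^ 'n"
  shows "v \<bullet> ((A + \<epsilon> *\<^sub>R mat 1) *v v) = v \<bullet> (A *v v) + \<epsilon> * (v \<bullet> v)"
  by (simp add: matrix_vector_mult_add_rdistrib inner_add_right flip: scaleR_matrix_vector_assoc)

lemma psd_add_scaled_mat_1:
  assumes "psd A" "0 \<le> \<epsilon>"
  shows "psd (A + \<epsilon> *\<^sub>R mat 1)"
proof -
  have "transpose (A + \<epsilon> *\<^sub>R mat 1) = transpose A + \<epsilon> *\<^sub>R mat 1"
    by (auto simp: transpose_def mat_def vec_eq_iff)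
  then show ?thesis
    using assms by (simp add: psd_def quadratic_form_add_scaled_mat_1)
qed

text \<open>Each \<open>l $ i * x $ i\<close> is one of the nonnegative summands of
  \<open>V0\<close>, which confines the set to a box.\<close>

lemma compact_feasible:
  assumes "l \<in> pos_orthant"
  shows "compact (feasible l V0)"
proof -
  have l: "0 < l $ i" for i using assms by (simp add: pos_orthant_def)
  have "x $ i \<le> V0 / l $ i" if "x \<in> feasible l V0" for x i
  proof -
    have x: "0 \<le> x $ j" for j using that by (simp add: feasible_def nonneg_orthant_def)
    have "l $ i * x $ i \<le> (\<Sum>j\<in>UNIV. l $ j * x $ j)"
      using l x by (intro member_le_sum) (auto simp: less_imp_le)
    also have "\<dots> = V0" using that by (simp add: feasible_def inner_vec_def)
    finally show ?thesis using l by (simp add: le_divide_eq mult.commute)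
  qed
  then have "feasible l V0 \<subseteq> cbox 0 (\<chi> i. V0 / l $ i)"
    by (auto simp: mem_box_cart feasible_def nonneg_orthant_def)
  then have "bounded (feasible l V0)" by (rule bounded_subset[OF bounded_cbox])
  moreover have "closed (feasible l V0)"
    unfolding feasible_def nonneg_orthant_def Collect_conj_eq mem_Collect_eq
    by (intro closed_Int closed_Collect_all closed_Collect_le closed_Collect_eq continuous_intros)
  ultimately show ?thesis by (simp add: compact_eq_bounded_closed)
qed

theorem corollary15:
  fixes K M :: "real ^ 'm \<Rightarrow> real ^ 'n ^ 'n"
    and l :: "real ^ 'm"
    and V0 :: real
    and x :: "real \<Rightarrow> real ^ 'm"
  assumes "continuous_on nonneg_orthant K"
    and "continuous_on nonneg_orthant M"
    and "\<And>y. y \<in> nonneg_orthant \<Longrightarrow> psd (K y)"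
    and "\<And>y. y \<in> nonneg_orthant \<Longrightarrow> psd (M y)"
    and "\<And>y. y \<in> pos_orthant \<Longrightarrow> pos_def (K y)"
    and "\<And>y. y \<in> pos_orthant \<Longrightarrow> pos_def (M y)"
    and "l \<in> pos_orthant"
    and "V0 > 0"
    and "\<And>\<epsilon>. \<epsilon> > 0 \<Longrightarrow> optimal_solution (phi_eps K M \<epsilon>) (feasible l V0) (x \<epsilon>)"
  shows "(\<exists>x_opt. optimal_solution (phi K M) (feasible l V0) x_opt) \<and>
    (\<forall>x_opt. optimal_solution (phi K M) (feasible l V0) x_opt \<longrightarrow>
       ((\<lambda>\<epsilon>. phi_eps K M \<epsilon> (x \<epsilon>)) \<longlongrightarrow> phi K M x_opt) (at_right 0)) \<and>
    (\<forall>p. limit_point_at_0 x p \<longrightarrow> optimal_solution (phi K M) (feasible l V0) p)"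
proof -
  let ?F = "feasible l V0"
  have F: "y \<in> nonneg_orthant" if "y \<in> ?F" for y
    using that by (simp add: feasible_def)
  have psdK: "psd (K y + \<epsilon> *\<^sub>R mat 1)" if "y \<in> ?F" "0 \<le> \<epsilon>" for y \<epsilon>
    using assms(3) F that by (simp add: psd_add_scaled_mat_1)
  have psdM: "psd (M y)" if "y \<in> ?F" for y
    using assms(4) F that by simp
  \<comment> \<open>Treating \<open>phi\<close> as the case \<open>\<epsilon> = 0\<close> lets one
    monotonicity fact and one sign fact serve both problems.\<close>
  have phi: "phi K M = phi_eps K M 0"
    by (simp add: phi_def phi_eps_def fun_eq_iff)
  have anti: "phi_eps K M \<epsilon>' y \<le> phi_eps K M \<epsilon> y" if "y \<in> ?F" "0 \<le> \<epsilon>" "\<epsilon> \<le> \<epsilon>'" for y \<epsilon> \<epsilon>'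
    unfolding phi_eps_def using that
    by (intro lambda_max_antimono psdM psdK)
      (auto simp: quadratic_form_add_scaled_mat_1 mult_right_mono)
  have nonneg: "0 \<le> phi_eps K M \<epsilon> y" if "y \<in> ?F" "0 \<le> \<epsilon>" for y \<epsilon>
    unfolding phi_eps_def using that by (intro lambda_max_nonneg psdM psdK)
  have x_in: "x \<epsilon> \<in> ?F" if "0 < \<epsilon>" for \<epsilon>
    using assms(9)[OF that] by (simp add: optimal_solution_def is_arg_min_def)
  have x_min: "phi_eps K M \<epsilon> (x \<epsilon>) \<le> phi_eps K M \<epsilon> y" if "0 < \<epsilon>" "y \<in> ?F" for \<epsilon> y
    using assms(9)[OF that(1)] that(2)
    by (auto simp: optimal_solution_def is_arg_min_linorder)

  have limit_in: "p \<in> ?F" if "\<And>k. 0 < e k" "(\<lambda>k. x (e k)) \<longlonglongrightarrow> p" for e :: "nat \<Rightarrow> real" and p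
    by (rule closed_sequentially[OF compact_imp_closed[OF compact_feasible[OF assms(7)]] _ that(2)])
      (simp add: x_in that(1))

  have limit_le: "phi K M p \<le> ereal c"
    if e: "\<And>k. 0 < e k" "e \<longlonglongrightarrow> 0" "(\<lambda>k. x (e k)) \<longlonglongrightarrow> p" and "0 \<le> c"
      and le: "\<And>k. phi_eps K M (e k) (x (e k)) \<le> ereal c" for e :: "nat \<Rightarrow> real" and p c
  proof -
    have p: "p \<in> ?F" using limit_in e(1,3) .
    have lim: "(\<lambda>k. f (x (e k))) \<longlonglongrightarrow> f p"
      if "continuous_on nonneg_orthant f" for f :: "real ^ 'm \<Rightarrow> real ^ 'n ^ 'n"
      by (rule continuous_on_tendsto_compose[OF that e(3)])
        (use F p x_in e(1) in auto)
    have "(\<lambda>k. K (x (e k)) + e k *\<^sub>R mat 1) \<longlonglongrightarrow> K p + 0 *\<^sub>R mat 1"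
      by (intro tendsto_intros lim assms(1) e(2))
    with lim[OF assms(2)] show ?thesis
      unfolding phi phi_eps_def
      by (rule lambda_max_closed_sublevel)
        (use psdM psdK psdK[OF p, of 0] x_in e(1) p le \<open>0 \<le> c\<close> in \<open>auto simp: phi_eps_def less_imp_le\<close>)
  qed

  have limit_opt: "optimal_solution (phi K M) ?F p" if "limit_point_at_0 x p" for p
  proof -
    obtain e :: "nat \<Rightarrow> real"
      where e: "\<And>k. 0 < e k" "e \<longlonglongrightarrow> 0" "(\<lambda>k. x (e k)) \<longlonglongrightarrow> p"
      using \<open>limit_point_at_0 x p\<close> unfolding limit_point_at_0_def by blast
    \<comment> \<open>For finite \<open>phi K M y = c\<close>, optimality of \<open>x (e k)\<close>
      and monotonicity in \<open>\<epsilon>\<close> bound every value along the sequence by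
      \<open>c\<close>.\<close>
    have "phi K M p \<le> phi K M y" if y: "y \<in> ?F" for y
    proof (cases "phi K M y")
      case (real c)
      have "phi_eps K M (e k) (x (e k)) \<le> ereal c" for k
        using order_trans[OF x_min[OF e(1) y] anti[OF y, of 0 "e k"]] e(1)[of k] real
        by (simp add: phi)
      moreover have "0 \<le> c" using nonneg[OF y, of 0] real by (simp add: phi)
      ultimately show ?thesis using limit_le[OF e] real by simp
    qed (use nonneg[OF y, of 0] phi in auto)
    then show ?thesis
      using limit_in[OF e(1,3)] by (simp add: optimal_solution_def is_arg_min_linorder)
  qed

  \<comment> \<open>Compactness supplies a limit point, which also proves that the unregularised
    minimum is attained.\<close>
  obtain e :: "nat \<Rightarrow> real" and p
    where e: "\<And>k. 0 < e k" "e \<longlonglongrightarrow> 0" "(\<lambda>k. x (e k)) \<longlonglongrightarrow> p"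
  proof -
    let ?d = "\<lambda>k. inverse (real (Suc k))"
    have "\<forall>k. x (?d k) \<in> ?F" by (simp add: x_in)
    then obtain p r where r: "strict_mono (r :: nat \<Rightarrow> nat)" "((\<lambda>k. x (?d k)) \<circ> r) \<longlonglongrightarrow> p"
      using compact_feasible[OF assms(7), of V0, unfolded compact_def, rule_format, of "\<lambda>k. x (?d k)"]
      by blast
    have "(?d \<circ> r) \<longlonglongrightarrow> 0"
      using LIMSEQ_inverse_real_of_nat r(1) by (rule LIMSEQ_subseq_LIMSEQ)
    with r(2) show thesis by (intro that[of "?d \<circ> r" p]) (simp_all add: o_def)
  qed

  have "optimal_solution (phi K M) ?F p"
    using e by (intro limit_opt) (auto simp: limit_point_at_0_def)

  moreover have "((\<lambda>\<epsilon>. phi_eps K M \<epsilon> (x \<epsilon>)) \<longlongrightarrow> phi K M y) (at_right 0)"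
    if opt: "optimal_solution (phi K M) ?F y" for y
  proof (rule order_tendstoI)
    have y: "y \<in> ?F" using opt by (simp add: optimal_solution_def is_arg_min_def)
    fix a assume a: "phi K M y < a"
    \<comment> \<open>The upper bound holds for every positive \<open>\<epsilon>\<close>, with
      \<open>y\<close> as competitor.\<close>
    have "phi_eps K M \<epsilon> (x \<epsilon>) < a" if "0 < \<epsilon>" for \<epsilon>
      using x_min[OF that y] anti[OF y, of 0 \<epsilon>] a that by (simp add: phi)
    then show "\<forall>\<^sub>F \<epsilon> in at_right 0. phi_eps K M \<epsilon> (x \<epsilon>) < a"
      by (rule eventually_mono[OF eventually_at_right_less])
  next
    have y_min: "phi K M y \<le> phi K M z" if "z \<in> ?F" for z
      using opt that by (auto simp: optimal_solution_def is_arg_min_linorder)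
    fix a assume a: "a < phi K M y"
    \<comment> \<open>One such \<open>\<epsilon>\<close> is enough, as optimal values grow when
      \<open>\<epsilon>\<close> shrinks. If there were none, \<open>a\<close> would bound all of
      them and hence \<open>phi K M p\<close>, below the minimum.\<close>
    have "\<exists>\<epsilon>>0. a < phi_eps K M \<epsilon> (x \<epsilon>)"
    proof (rule ccontr)
      assume "\<not> ?thesis"
      then have le: "phi_eps K M \<epsilon> (x \<epsilon>) \<le> a" if "0 < \<epsilon>" for \<epsilon> using that by force
      \<comment> \<open>\<open>a\<close> is an extended real: this bound and
        \<open>a < phi K M y\<close> make it a finite nonnegative number, as \<open>limit_le\<close>
        requires.\<close>
      have "0 \<le> a" using nonneg[OF x_in, of 1 1] le[of 1] by simp
      then obtain c where c: "a = ereal c" "0 \<le> c" using a by (cases a) auto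
      have "phi K M p \<le> a"
        using limit_le[OF e c(2)] le e(1) c(1) by simp
      then show False using a y_min[OF limit_in[OF e(1,3)]] by simp
    qed
    then obtain \<delta> where \<delta>: "0 < \<delta>" "a < phi_eps K M \<delta> (x \<delta>)" by blast
    \<comment> \<open>\<open>x \<epsilon>\<close> competes in the problem for
      \<open>\<delta>\<close>; lowering the parameter to \<open>\<epsilon>\<close> then only raises
      its value.\<close>
    have "a < phi_eps K M \<epsilon> (x \<epsilon>)" if "0 < \<epsilon>" "\<epsilon> < \<delta>" for \<epsilon>
    proof -
      note \<delta>(2)
      also have "phi_eps K M \<delta> (x \<delta>) \<le> phi_eps K M \<delta> (x \<epsilon>)"
        using \<delta>(1) x_in that(1) by (intro x_min)
      also have "\<dots> \<le> phi_eps K M \<epsilon> (x \<epsilon>)"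
        using x_in that by (intro anti) auto
      finally show ?thesis .
    qed
    then show "\<forall>\<^sub>F \<epsilon> in at_right 0. a < phi_eps K M \<epsilon> (x \<epsilon>)"
      using \<delta>(1) by (auto simp: eventually_at_right_field)
  qed

  ultimately show ?thesis using limit_opt by blast
qed

end
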